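(* Let ${\bf v}\in\mathcal V$. (a) If ${\bf v}$ has at most $\lfloor n/2\rfloor$ positive prizes (i.e. $v_r=0$ for all $r>\lfloor n/2\rfloor$), then $L({\bf v})\le 0$, so $M({\bf v},\theta)$ and the symmetric equilibrium effort $x^*({\bf v},\theta)$ are nonincreasing in $\theta\in[0,1]$ (effort decreases with loss aversion). (b) If ${\bf v}$ has at least $\lceil n/2\rceil$ equal prizes at the top (i.e. $v_1=v_2=\dots=v_{\lceil n/2\rceil}$), then $L({\bf v})\ge 0$, so $M({\bf v},\theta)$ and $x^*({\bf v},\theta)$ are nondecreasing in $\theta\in[0,1]$ (effort increases with loss aversion).
   Context: Fix an integer $n\ge 2$ and a noise distribution with cdf $F$ and density $f$ on $\mathbb R$ (integrals finite). For $r=1,\dots,n$ let $g_r(u)=u^{n-r}(1-u)^{r-1}$ and $\beta_r=\binom{n-1}{r-1}\int g_r'(F(t))f(t)^2dt$; $B_r=\sum_{k=1}^r\beta_k$. Let $\mathcal V=\{{\bf v}\in\mathbb R^n: v_1\ge\dots\ge v_n\ge 0,\ \sum_r v_r=1\}$, $R({\bf v})=\sum_r\beta_rv_r$, $L({\bf v})=-\frac1n\sum_{r=1}^n\sum_{s<r}(\beta_r+\beta_s)(v_s-v_r)$, $M({\bf v},\theta)=R({\bf v})+\theta L({\bf v})$ with loss-aversion parameter $\theta\in[0,1]$. The effort cost $c$ is strictly increasing, differentiable and strictly convex on $[0,\bar x]$, $\bar x=c^{-1}(1)$, with $c(0)=c'(0)=0$. The symmetric equilibrium effort $x^*({\bf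 v},\theta)$ is the effort solving the first-order condition $c'(x^* )=M({\bf v},\theta)$; since $c'$ is strictly increasing, $x^*$ is a strictly increasing function of $M({\bf v},\theta)$. *)

theory Defs
  imports "HOL-Analysis.Analysis"
begin

text \<open>Prize vectors are functions nat => real, indexed by r = 1..n.\<close>

definition g :: "nat \<Rightarrow> nat \<Rightarrow> real \<Rightarrow> real" where
  "g n r u = u ^ (n - r) * (1 - u) ^ (r - 1)"

definition beta :: "(real \<Rightarrow> real) \<Rightarrow> (real \<Rightarrow> real) \<Rightarrow> nat \<Rightarrow> nat \<Rightarrow> real" where
  "beta F f n r = real ((n - 1) choose (r - 1)) *
      (LINT t|lborel. deriv (g n r) (F t) * (f t)^2)"

definition Bsum :: "(real \<Rightarrow> real) \<Rightarrow> (real \<Rightarrow> real) \<Rightarrow> nat \<Rightarrow> nat \<Rightarrow> real" where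
  "Bsum F f n r = (\<Sum>k=1..r. beta F f n k)"

definition prizeV :: "nat \<Rightarrow> (nat \<Rightarrow> real) set" where
  "prizeV n = {v. (\<forall>r. 1 \<le> r \<and> r < n \<longrightarrow> v (Suc r) \<le> v r) \<and> v n \<ge> 0
                 \<and> (\<Sum>r=1..n. v r) = 1}"

definition Rf :: "(real \<Rightarrow> real) \<Rightarrow> (real \<Rightarrow> real) \<Rightarrow> nat \<Rightarrow> (nat \<Rightarrow> real) \<Rightarrow> real" where
  "Rf F f n v = (\<Sum>r=1..n. beta F f n r * v r)"

definition Lf :: "(real \<Rightarrow> real) \<Rightarrow> (real \<Rightarrow> real) \<Rightarrow> nat \<Rightarrow> (nat \<Rightarrow> real) \<Rightarrow> real" where
  "Lf F f n v = - (1 / real n) * (\<Sum>r=1..n. \<Sum>s=1..<r.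
       (beta F f n r + beta F f n s) * (v s - v r))"

definition Mf :: "(real \<Rightarrow> real) \<Rightarrow> (real \<Rightarrow> real) \<Rightarrow> nat \<Rightarrow> (nat \<Rightarrow> real) \<Rightarrow> real \<Rightarrow> real" where
  "Mf F f n v \<theta> = Rf F f n v + \<theta> * Lf F f n v"

definition strictly_convex_on :: "real set \<Rightarrow> (real \<Rightarrow> real) \<Rightarrow> bool" where
  "strictly_convex_on S c \<longleftrightarrow> (\<forall>x\<in>S. \<forall>y\<in>S. \<forall>t. x \<noteq> y \<and> 0 < t \<and> t < 1 \<longrightarrow>
      c ((1 - t) * x + t * y) < (1 - t) * c x + t * c y)"

end

theory Submission imports Defs begin

text \<open>With \<open>B j = \<beta> 1 + \<dots> + \<beta> j\<close>, summation by parts turns the double sum into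
  \<open>L v = (1/n) \<Sum>j<n. (v j - v (j+1)) (2j - n) B j\<close>, provided \<open>B n = 0\<close>. The weighted
  derivatives \<open>C(n-1,k-1) g\<^sub>k'\<close> telescope: the integrand of \<open>B j\<close> is
  \<open>(n-1) C(n-2,j-1) F^(n-1-j) (1-F)^(j-1) f\<^sup>2 \<ge> 0\<close> for \<open>j < n\<close>, and it vanishes for \<open>j = n\<close>.
  As \<open>v\<close> is nonincreasing, each term has the sign of \<open>2j - n\<close> or vanishes: in (a) the terms
  with \<open>2j > n\<close> vanish since \<open>v j = v (j+1) = 0\<close>, in (b) those with \<open>2j < n\<close> vanish since
  \<open>v j = v (j+1)\<close>. Finally \<open>M\<close> is affine in \<open>\<theta>\<close> with slope \<open>L\<close>, and the effort inherits its
  monotonicity because strict convexity makes \<open>c'\<close> strictly increasing.\<close>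

lemma summation_by_parts:
  fixes b v :: "nat \<Rightarrow> real"
  shows "(\<Sum>j=1..<n. (v j - v (j+1)) * (\<Sum>k=1..j. b k))
       = (\<Sum>j=1..n. v j * b j) - v n * (\<Sum>k=1..n. b k)"
proof (induction n)
  case (Suc n)
  show ?case
  proof (cases "n = 0")
    case False
    then have "(\<Sum>j=1..<Suc n. (v j - v (j+1)) * (\<Sum>k=1..j. b k))
      = (\<Sum>j=1..<n. (v j - v (j+1)) * (\<Sum>k=1..j. b k)) + (v n - v (n+1)) * (\<Sum>k=1..n. b k)"
      by simp
    then show ?thesis using Suc.IH by (simp add: algebra_simps)
  qed simp
qed simp

lemma sum_pairs_by_parts:
  fixes b v :: "nat \<Rightarrow> real"
  shows "(\<Sum>r=1..m. \<Sum>s=1..<r. (b r + b s) * (v s - v r)) =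
     (\<Sum>j=1..<m. (v j - v (j+1)) * (real m - 2 * real j) * (\<Sum>k=1..j. b k))
     - real m * v m * (\<Sum>k=1..m. b k) + (\<Sum>k=1..m. b k) * (\<Sum>k=1..m. v k)"
proof (induction m)
  case (Suc n)
  define B where "B = (\<lambda>j. \<Sum>k=1..j. b k)"
  define V where "V = (\<Sum>k=1..n. v k)"
  have new_row: "(\<Sum>s=1..n. (b (Suc n) + b s) * (v s - v (Suc n)))
      = b (Suc n) * V + (\<Sum>s=1..n. v s * b s) - real n * b (Suc n) * v (Suc n) - B n * v (Suc n)"
    unfolding V_def B_def
    by (simp add: algebra_simps sum.distrib sum_subtractf sum_distrib_left sum_distrib_right)
  have "(\<Sum>j=1..<n. (v j - v (j+1)) * (real (Suc n) - 2 * real j) * B j)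
      = (\<Sum>j=1..<n. (v j - v (j+1)) * (real n - 2 * real j) * B j + (v j - v (j+1)) * B j)"
    by (intro sum.cong) (simp_all add: algebra_simps)
  then have weights: "(\<Sum>j=1..<n. (v j - v (j+1)) * (real (Suc n) - 2 * real j) * B j)
      = (\<Sum>j=1..<n. (v j - v (j+1)) * (real n - 2 * real j) * B j)
        + ((\<Sum>j=1..n. v j * b j) - v n * B n)"
    using summation_by_parts[of v b n] by (simp add: B_def sum.distrib)
  have "(\<Sum>r=1..Suc n. \<Sum>s=1..<r. (b r + b s) * (v s - v r)) =
      (\<Sum>r=1..n. \<Sum>s=1..<r. (b r + b s) * (v s - v r)) + (\<Sum>s=1..n. (b (Suc n) + b s) * (v s - v (Suc n)))"
    by (simp add: atLeastLessThanSuc_atLeastAtMost)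
  then show ?case
    unfolding Suc.IH new_row B_def[symmetric]
    using weights by (cases "n = 0") (simp_all add: B_def V_def algebra_simps)
qed simp

text \<open>Each exponent that natural subtraction may truncate
  (\<open>n - k - 1\<close> for \<open>k = n\<close>, \<open>k - 2\<close> for \<open>k = 1\<close>) carries a vanishing coefficient.\<close>

definition dg :: "nat \<Rightarrow> nat \<Rightarrow> real \<Rightarrow> real" where
  "dg n k u = real (n - k) * u ^ (n - k - 1) * (1 - u) ^ (k - 1)
              - real (k - 1) * u ^ (n - k) * (1 - u) ^ (k - 2)"

lemma g_has_real_derivative: "(g n k has_real_derivative dg n k u) (at u)"
proof -
  have "((\<lambda>u. u ^ (n - k) * (1 - u) ^ (k - 1)) has_real_derivative
     real (n - k) * u ^ (n - k - 1) * (1 - u) ^ (k - 1)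
     + u ^ (n - k) * (real (k - 1) * (1 - u) ^ (k - 1 - 1) * (- 1))) (at u)"
    by (intro derivative_eq_intros) auto
  then show ?thesis
    unfolding g_def[abs_def] dg_def by (simp add: algebra_simps numeral_2_eq_2)
qed

lemma deriv_g: "deriv (g n k) = dg n k"
  using g_has_real_derivative DERIV_imp_deriv by blast

lemma binomial_dg_partial_sum:
  assumes "1 \<le> r" "r \<le> m"
  shows "(\<Sum>k=1..r. real (m choose (k - 1)) * dg (Suc m) k u)
     = real m * real ((m - 1) choose (r - 1)) * u ^ (m - r) * (1 - u) ^ (r - 1)"
  using assms
proof (induction r rule: nat_induct_at_least)
  case base
  then show ?case by (simp add: dg_def)
next
  case (Suc r)
  obtain p q where p: "r = Suc p" and q: "m - r = Suc q"
    using Suc.hyps Suc.prems by (metis Suc_diff_Suc Suc_le_eq not0_implies_Suc not_one_le_zero)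
  have absorb_comp: "real (m choose r) * real (m - r) = real m * real ((m - 1) choose r)"
    using binomial_absorb_comp[of m r] by (metis of_nat_mult mult.commute)
  have absorb: "real (m choose r) * real r = real m * real ((m - 1) choose (r - 1))"
    using binomial_absorption[of p m] p by (metis diff_Suc_1 of_nat_mult mult.commute)
  have "(\<Sum>k=1..Suc r. real (m choose (k - 1)) * dg (Suc m) k u)
      = real m * real ((m - 1) choose (r - 1)) * u ^ (m - r) * (1 - u) ^ (r - 1)
        + real (m choose r) * dg (Suc m) (Suc r) u"
    using Suc by simp
  also have "dg (Suc m) (Suc r) u = real (m - r) * u ^ q * (1 - u) ^ r - real r * u ^ (m - r) * (1 - u) ^ p"
    unfolding dg_def using q p by simp
  also have "real m * real ((m - 1) choose (r - 1)) * u ^ (m - r) * (1 - u) ^ (r - 1)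
        + real (m choose r) * (real (m - r) * u ^ q * (1 - u) ^ r - real r * u ^ (m - r) * (1 - u) ^ p)
      = (real (m choose r) * real (m - r)) * u ^ q * (1 - u) ^ r
        + (real m * real ((m - 1) choose (r - 1)) - real (m choose r) * real r) * u ^ (m - r) * (1 - u) ^ p"
    using p by (simp add: algebra_simps)
  also have "\<dots> = real m * real ((m - 1) choose (Suc r - 1)) * u ^ (m - Suc r) * (1 - u) ^ (Suc r - 1)"
  proof -
    have "m - Suc r = q" using q by simp
    then show ?thesis unfolding absorb_comp absorb using p by simp
  qed
  finally show ?case .
qed

lemma binomial_dg_partial_sum_nonneg:
  assumes "1 \<le> r" "r < n" "0 \<le> u" "u \<le> 1"
  shows "(\<Sum>k=1..r. real ((n - 1) choose (k - 1)) * dg n k u) \<ge> 0"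
proof -
  obtain m where "n = Suc m" using assms by (cases n) auto
  then show ?thesis using binomial_dg_partial_sum[of r m u] assms by simp
qed

lemma binomial_dg_sum_eq_0:
  assumes "2 \<le> n"
  shows "(\<Sum>k=1..n. real ((n - 1) choose (k - 1)) * dg n k u) = 0"
proof -
  obtain m where m: "n = Suc m" "1 \<le> m" using assms by (cases n) auto
  have "(\<Sum>k=1..Suc m. real (m choose (k - 1)) * dg (Suc m) k u)
      = real m * (1 - u) ^ (m - 1) + dg (Suc m) (Suc m) u"
    using binomial_dg_partial_sum[of m m u] m(2) by simp
  also have "dg (Suc m) (Suc m) u = - real m * (1 - u) ^ (m - 1)"
    unfolding dg_def using m by (simp add: numeral_2_eq_2)
  finally show ?thesis using m by simp
qed

text \<open>The library's \<open>convex_on_imp_above_tangent\<close> needs \<open>c\<close> in the interior; here \<open>c\<close> may be an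
  endpoint, and the one-sided difference quotient suffices.\<close>

lemma convex_on_Icc_imp_above_tangent:
  fixes f :: "real \<Rightarrow> real"
  assumes convex: "convex_on {a..b} f" and c: "c \<in> {a..b}" and x: "x \<in> {a..b}"
    and deriv: "(f has_field_derivative f') (at c within {a..b})"
  shows "f x - f c \<ge> f' * (x - c)"
proof (cases x c rule: linorder_cases)
  assume xc: "x > c"
  let ?A = "{c<..<x}"
  have "at c within ?A \<noteq> bot" using xc by (simp add: at_within_eq_bot_iff)
  moreover from deriv have "((\<lambda>y. (f y - f c) / (y - c)) \<longlongrightarrow> f') (at c within ?A)"
    unfolding has_field_derivative_iff using c x by (elim tendsto_mono[rotated]) (intro at_le, auto)
  moreover have "eventually (\<lambda>y. (f y - f c) / (y - c) \<le> (f x - f c) / (x - c)) (at c within ?A)"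
    unfolding eventually_at_filter
  proof (intro always_eventually allI impI)
    fix y assume y: "y \<noteq> c" "y \<in> ?A"
    with convex x c have "f y - f c \<le> (f x - f c) / (x - c) * (y - c)"
      using convex_onD_Icc'[OF convex_on_subset[OF convex], of c x y] by auto
    then show "(f y - f c) / (y - c) \<le> (f x - f c) / (x - c)"
      using y xc by (simp add: field_split_simps)
  qed
  ultimately have "f' \<le> (f x - f c) / (x - c)" by (simp add: tendsto_upperbound)
  then show ?thesis using xc by (simp add: field_simps)
next
  assume xc: "x < c"
  let ?A = "{x<..<c}"
  have "at c within ?A \<noteq> bot" using xc by (simp add: at_within_eq_bot_iff)
  moreover from deriv have "((\<lambda>y. (f y - f c) / (y - c)) \<longlongrightarrow> f') (at c within ?A)"
    unfolding has_field_derivative_iff using c x by (elim tendsto_mono[rotated]) (intro at_le, auto)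
  moreover have "eventually (\<lambda>y. (f y - f c) / (y - c) \<ge> (f x - f c) / (x - c)) (at c within ?A)"
    unfolding eventually_at_filter
  proof (intro always_eventually allI impI)
    fix y assume y: "y \<noteq> c" "y \<in> ?A"
    with convex x c have "f y - f c \<le> (f x - f c) * ((c - y) / (c - x))"
      using convex_onD_Icc''[OF convex_on_subset[OF convex], of x c y] by auto
    also have "(c - y) / (c - x) = (y - c) / (x - c)" using y xc by (simp add: field_simps)
    finally show "(f y - f c) / (y - c) \<ge> (f x - f c) / (x - c)"
      using y xc by (simp add: field_split_simps)
  qed
  ultimately have "f' \<ge> (f x - f c) / (x - c)" by (simp add: tendsto_lowerbound)
  then show ?thesis using xc by (simp add: field_simps)
qed simp_all

lemma strictly_convex_on_imp_convex_on:
  "strictly_convex_on {a..b} f \<Longrightarrow> convex_on {a..b} f"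
  by (rule convex_on_linorderI) (auto simp: strictly_convex_on_def less_eq_real_def)

lemma strictly_convex_on_Icc_imp_above_tangent:
  fixes f :: "real \<Rightarrow> real"
  assumes sc: "strictly_convex_on {a..b} f" and x: "x \<in> {a..b}" and y: "y \<in> {a..b}" and "x \<noteq> y"
    and deriv: "(f has_real_derivative f') (at x within {a..b})"
  shows "f y - f x > f' * (y - x)"
proof -
  define z where "z = (1 - 1/2) * x + (1/2) * y"
  have z: "z \<in> {a..b}" using x y unfolding z_def by auto
  have "f z < (1 - 1/2) * f x + (1/2) * f y"
    unfolding z_def by (rule sc[unfolded strictly_convex_on_def, rule_format]) (use x y \<open>x \<noteq> y\<close> in auto)
  moreover have "f z - f x \<ge> f' * (z - x)"
    by (rule convex_on_Icc_imp_above_tangent[OF strictly_convex_on_imp_convex_on[OF sc] x z deriv])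
  ultimately show ?thesis unfolding z_def by (simp add: algebra_simps)
qed

lemma strictly_convex_on_Icc_deriv_le_imp_le:
  fixes f :: "real \<Rightarrow> real"
  assumes sc: "strictly_convex_on {a..b} f" and x: "x \<in> {a..b}" and y: "y \<in> {a..b}"
    and deriv: "\<And>z. z \<in> {a..b} \<Longrightarrow> (f has_real_derivative f' z) (at z within {a..b})"
    and le: "f' x \<le> f' y"
  shows "x \<le> y"
proof (rule ccontr)
  assume "\<not> x \<le> y"
  then have "f x - f y > f' y * (x - y)" "f y - f x > f' x * (y - x)"
    using strictly_convex_on_Icc_imp_above_tangent[OF sc, where f' = "f' _"] x y deriv by auto
  then have "(f' x - f' y) * (x - y) > 0" by (simp add: algebra_simps)
  with \<open>\<not> x \<le> y\<close> le show False by (simp add: zero_less_mult_iff)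
qed

lemma cdf_bounds:
  fixes f :: "real \<Rightarrow> real"
  assumes f_nonneg: "\<And>t. f t \<ge> 0" and f_int: "integrable lborel f"
    and f_total: "(LINT t|lborel. f t) = 1"
  shows "0 \<le> (LINT t:{..x}|lborel. f t) \<and> (LINT t:{..x}|lborel. f t) \<le> 1"
proof
  show "0 \<le> (LINT t:{..x}|lborel. f t)" unfolding set_lebesgue_integral_def
    by (intro integral_nonneg_AE) (auto simp: f_nonneg)
  have "integrable lborel (\<lambda>t. indicator {..x} t *\<^sub>R f t)"
    by (rule integrable_mult_indicator) (auto simp: f_int)
  then have "(LINT t:{..x}|lborel. f t) \<le> (LINT t|lborel. f t)"
    unfolding set_lebesgue_integral_def
    by (intro integral_mono) (auto simp: f_nonneg f_int indicator_def)
  then show "(LINT t:{..x}|lborel. f t) \<le> 1" using f_total by simp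
qed

lemma Bsum_eq_integral:
  assumes ints: "\<And>r. 1 \<le> r \<Longrightarrow> r \<le> n \<Longrightarrow> integrable lborel (\<lambda>t. deriv (g n r) (F t) * (f t)^2)"
    and "j \<le> n"
  shows "Bsum F f n j =
    (LINT t|lborel. (\<Sum>k=1..j. real ((n - 1) choose (k - 1)) * dg n k (F t)) * (f t)^2)"
proof -
  have "Bsum F f n j = (\<Sum>k=1..j. LINT t|lborel. real ((n - 1) choose (k - 1)) * (dg n k (F t) * (f t)^2))"
    unfolding Bsum_def beta_def deriv_g by simp
  also have "\<dots> = (LINT t|lborel. (\<Sum>k=1..j. real ((n - 1) choose (k - 1)) * (dg n k (F t) * (f t)^2)))"
    using ints \<open>j \<le> n\<close> unfolding deriv_g
    by (intro Bochner_Integration.integral_sum[symmetric] integrable_mult_right) auto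
  finally show ?thesis by (simp add: sum_distrib_right mult.assoc)
qed

lemma Bsum_nonneg:
  assumes ints: "\<And>r. 1 \<le> r \<Longrightarrow> r \<le> n \<Longrightarrow> integrable lborel (\<lambda>t. deriv (g n r) (F t) * (f t)^2)"
    and F_bounds: "\<And>t. 0 \<le> F t \<and> F t \<le> 1" and "1 \<le> j" "j < n"
  shows "Bsum F f n j \<ge> 0"
proof -
  have "Bsum F f n j =
      (LINT t|lborel. (\<Sum>k=1..j. real ((n - 1) choose (k - 1)) * dg n k (F t)) * (f t)^2)"
    using Bsum_eq_integral[OF ints] \<open>j < n\<close> by simp
  also have "\<dots> \<ge> 0"
    by (intro integral_nonneg_AE AE_I2 mult_nonneg_nonneg binomial_dg_partial_sum_nonneg)
       (use assms in auto)
  finally show ?thesis .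
qed

lemma Bsum_top_eq_0:
  assumes ints: "\<And>r. 1 \<le> r \<Longrightarrow> r \<le> n \<Longrightarrow> integrable lborel (\<lambda>t. deriv (g n r) (F t) * (f t)^2)"
    and "2 \<le> n"
  shows "Bsum F f n n = 0"
  using Bsum_eq_integral[OF ints order_refl] binomial_dg_sum_eq_0[OF \<open>2 \<le> n\<close>] by simp

lemma Lf_by_parts:
  assumes "Bsum F f n n = 0"
  shows "Lf F f n v = (1 / real n) *
    (\<Sum>j=1..<n. (v j - v (j+1)) * (2 * real j - real n) * Bsum F f n j)"
proof -
  have "- (\<Sum>j=1..<n. (v j - v (j+1)) * (real n - 2 * real j) * Bsum F f n j)
      = (\<Sum>j=1..<n. (v j - v (j+1)) * (2 * real j - real n) * Bsum F f n j)"
    unfolding sum_negf[symmetric] by (intro sum.cong) (simp_all add: algebra_simps)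
  moreover have "Lf F f n v = - (1 / real n) *
      (\<Sum>j=1..<n. (v j - v (j+1)) * (real n - 2 * real j) * Bsum F f n j)"
    unfolding Lf_def sum_pairs_by_parts Bsum_def[symmetric] using assms by simp
  ultimately show ?thesis by (metis mult_minus_left mult_minus_right)
qed

lemma prizeV_antimono: "v \<in> prizeV n \<Longrightarrow> 1 \<le> j \<Longrightarrow> j < n \<Longrightarrow> v (j+1) \<le> v j"
  unfolding prizeV_def by auto

lemma Lf_nonpos_if_few_prizes:
  assumes "v \<in> prizeV n" and B_nonneg: "\<And>j. 1 \<le> j \<Longrightarrow> j < n \<Longrightarrow> Bsum F f n j \<ge> 0"
    and "Bsum F f n n = 0" and no_prize: "\<And>r. n div 2 < r \<Longrightarrow> r \<le> n \<Longrightarrow> v r = 0"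
  shows "Lf F f n v \<le> 0"
proof -
  have term_nonpos: "(v j - v (j+1)) * (2 * real j - real n) * Bsum F f n j \<le> 0"
    if "j \<in> {1..<n}" for j
  proof (cases "j \<le> n div 2")
    case True
    then have "2 * real j - real n \<le> 0" by linarith
    then show ?thesis using prizeV_antimono[OF \<open>v \<in> prizeV n\<close>] B_nonneg that
      by (simp add: mult_nonneg_nonpos mult_nonpos_nonneg)
  next
    case False
    then show ?thesis using no_prize that by simp
  qed
  show ?thesis unfolding Lf_by_parts[OF \<open>Bsum F f n n = 0\<close>]
    by (intro mult_nonneg_nonpos[OF _ sum_nonpos[OF term_nonpos]]) simp
qed

lemma Lf_nonneg_if_equal_top_prizes:
  assumes "v \<in> prizeV n" and B_nonneg: "\<And>j. 1 \<le> j \<Longrightarrow> j < n \<Longrightarrow> Bsum F f n j \<ge> 0"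
    and "Bsum F f n n = 0" and top: "\<And>r. 1 \<le> r \<Longrightarrow> r \<le> (n + 1) div 2 \<Longrightarrow> v r = v 1"
  shows "Lf F f n v \<ge> 0"
proof -
  have term_nonneg: "(v j - v (j+1)) * (2 * real j - real n) * Bsum F f n j \<ge> 0"
    if "j \<in> {1..<n}" for j
  proof (cases "j < (n + 1) div 2")
    case True
    then have "v j = v (j+1)" using top[of j] top[of "j+1"] that by simp
    then show ?thesis by simp
  next
    case False
    then have "2 * real j - real n \<ge> 0" by linarith
    then show ?thesis using prizeV_antimono[OF \<open>v \<in> prizeV n\<close>] B_nonneg that by simp
  qed
  show ?thesis unfolding Lf_by_parts[OF \<open>Bsum F f n n = 0\<close>]
    by (intro mult_nonneg_nonneg[OF _ sum_nonneg[OF term_nonneg]]) simp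
qed

lemma Mf_mono_theta: "Lf F f n v \<ge> 0 \<Longrightarrow> \<theta>1 \<le> \<theta>2 \<Longrightarrow> Mf F f n v \<theta>1 \<le> Mf F f n v \<theta>2"
  unfolding Mf_def by (simp add: mult_right_mono)

lemma Mf_antimono_theta: "Lf F f n v \<le> 0 \<Longrightarrow> \<theta>1 \<le> \<theta>2 \<Longrightarrow> Mf F f n v \<theta>2 \<le> Mf F f n v \<theta>1"
  unfolding Mf_def by (simp add: mult_right_mono_neg)

theorem proposition1:
  fixes n :: nat and F f :: "real \<Rightarrow> real"
    and c c' :: "real \<Rightarrow> real" and xbar :: real and v :: "nat \<Rightarrow> real"
  assumes n2: "n \<ge> 2"
    and f_meas: "f \<in> borel_measurable borel"
    and f_nonneg: "\<And>t. f t \<ge> 0"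
    and f_int: "integrable lborel f"
    and f_total: "(LINT t|lborel. f t) = 1"
    and F_cdf: "\<And>x. F x = (LINT t:{..x}|lborel. f t)"
    and finite_ints: "\<And>r. 1 \<le> r \<Longrightarrow> r \<le> n \<Longrightarrow>
         integrable lborel (\<lambda>t. deriv (g n r) (F t) * (f t)^2)"
    and xbar_pos: "xbar > 0"
    and c_xbar: "c xbar = 1"
    and c_mono: "strict_mono_on {0..xbar} c"
    and c_deriv: "\<And>x. x \<in> {0..xbar} \<Longrightarrow> (c has_real_derivative c' x) (at x within {0..xbar})"
    and c_convex: "strictly_convex_on {0..xbar} c"
    and c0: "c 0 = 0" and c'0: "c' 0 = 0"
    and vV: "v \<in> prizeV n"
  shows
   "((\<forall>r. n div 2 < r \<and> r \<le> n \<longrightarrow> v r = 0) \<longrightarrow>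
       Lf F f n v \<le> 0 \<and>
       (\<forall>\<theta>1 \<theta>2. 0 \<le> \<theta>1 \<and> \<theta>1 \<le> \<theta>2 \<and> \<theta>2 \<le> 1 \<longrightarrow>
          Mf F f n v \<theta>2 \<le> Mf F f n v \<theta>1 \<and>
          (\<forall>x1 x2. x1 \<in> {0..xbar} \<and> x2 \<in> {0..xbar} \<and>
              c' x1 = Mf F f n v \<theta>1 \<and> c' x2 = Mf F f n v \<theta>2 \<longrightarrow> x2 \<le> x1)))
    \<and>
    ((\<forall>r. 1 \<le> r \<and> r \<le> (n + 1) div 2 \<longrightarrow> v r = v 1) \<longrightarrow>
       Lf F f n v \<ge> 0 \<and>
       (\<forall>\<theta>1 \<theta>2. 0 \<le> \<theta>1 \<and> \<theta>1 \<le> \<theta>2 \<and> \<theta>2 \<le> 1 \<longrightarrow>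
          Mf F f n v \<theta>1 \<le> Mf F f n v \<theta>2 \<and>
          (\<forall>x1 x2. x1 \<in> {0..xbar} \<and> x2 \<in> {0..xbar} \<and>
              c' x1 = Mf F f n v \<theta>1 \<and> c' x2 = Mf F f n v \<theta>2 \<longrightarrow> x1 \<le> x2)))"
proof -
  have F_bounds: "\<And>t. 0 \<le> F t \<and> F t \<le> 1"
    unfolding F_cdf using cdf_bounds[OF f_nonneg f_int f_total] .
  note B_nonneg = Bsum_nonneg[OF finite_ints F_bounds]
  note B_top = Bsum_top_eq_0[OF finite_ints n2]
  have effort_le: "x \<le> y" if "x \<in> {0..xbar}" "y \<in> {0..xbar}" "c' x \<le> c' y" for x y
    using strictly_convex_on_Icc_deriv_le_imp_le[OF c_convex that(1,2) c_deriv that(3)] .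
  show ?thesis
  proof (intro conjI impI allI)
    assume "\<forall>r. n div 2 < r \<and> r \<le> n \<longrightarrow> v r = 0"
    then show L: "Lf F f n v \<le> 0"
      using Lf_nonpos_if_few_prizes[OF vV B_nonneg B_top] by blast
    fix \<theta>1 \<theta>2 :: real assume "0 \<le> \<theta>1 \<and> \<theta>1 \<le> \<theta>2 \<and> \<theta>2 \<le> 1"
    then show M: "Mf F f n v \<theta>2 \<le> Mf F f n v \<theta>1" using Mf_antimono_theta[OF L] by blast
    fix x1 x2 assume "x1 \<in> {0..xbar} \<and> x2 \<in> {0..xbar} \<and>
      c' x1 = Mf F f n v \<theta>1 \<and> c' x2 = Mf F f n v \<theta>2"
    with M show "x2 \<le> x1" using effort_le[of x2 x1] by simp
  next
    assume "\<forall>r. 1 \<le> r \<and> r \<le> (n + 1) div 2 \<longrightarrow> v r = v 1"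
    then show L: "Lf F f n v \<ge> 0"
      using Lf_nonneg_if_equal_top_prizes[OF vV B_nonneg B_top] by blast
    fix \<theta>1 \<theta>2 :: real assume "0 \<le> \<theta>1 \<and> \<theta>1 \<le> \<theta>2 \<and> \<theta>2 \<le> 1"
    then show M: "Mf F f n v \<theta>1 \<le> Mf F f n v \<theta>2" using Mf_mono_theta[OF L] by blast
    fix x1 x2 assume "x1 \<in> {0..xbar} \<and> x2 \<in> {0..xbar} \<and>
      c' x1 = Mf F f n v \<theta>1 \<and> c' x2 = Mf F f n v \<theta>2"
    with M show "x1 \<le> x2" using effort_le[of x1 x2] by simp
  qed
qed

end
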